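(* For every $n\ge 1$, $$n!\sum_{T\in PT(n)}\prod_{h\in\mathcal{H}(T)}\Big(1-\frac{1}{h}\Big)^{h-1}=(n-1)^{n-1}.$$
   Context: A plane tree is a rooted unlabeled tree in which the (nonempty) subtrees of each vertex are arranged in linear order; $PT(n)$ is the set of plane trees with $n$ vertices. For a vertex $u$ of a tree $T$, the hook length $h_u$ is the number of descendants of $u$ (counting $u$ itself), and $\mathcal{H}(T)$ is the multiset of hook lengths of the vertices; the product is over all vertices. The convention $0^0=1$ is used. *)

theory Defs
  imports Complex_Main "HOL-Library.Multiset" "HOL-Library.Sublist"
begin

datatype plane_tree = Node (subtrees: "plane_tree list")

text \<open>
  A vertex is identified by its address, i.e. the list of child indices (counted from 0) on the path
  from the root to it. The root is \<open>[]\<close>.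
\<close>

function vertices :: "plane_tree \<Rightarrow> nat list set" where
  "vertices (Node ts) = insert [] (\<Union>i<length ts. (#) i ` vertices (ts ! i))"
  by pat_completeness auto
termination
proof (relation "measure size")
  fix ts :: "plane_tree list" and i
  assume "i \<in> {..<length ts}"
  then have "size (ts ! i) < Suc (size_list size ts)"
    by (auto simp: less_Suc_eq_le intro: size_list_estimation'[OF nth_mem])
  then show "(ts ! i, Node ts) \<in> measure size" by simp
qed auto

definition PT :: "nat \<Rightarrow> plane_tree set" where
  "PT n = {T. card (vertices T) = n}"

text \<open>In terms of addresses, \<open>v\<close> is a descendant of \<open>u\<close> (possibly \<open>u\<close> itself) iff \<open>u\<close> is a prefix of \<open>v\<close>.\<close>

definition descendants :: "plane_tree \<Rightarrow> nat list \<Rightarrow> nat list set" where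
  "descendants T u = {v \<in> vertices T. prefix u v}"

definition hook_length :: "plane_tree \<Rightarrow> nat list \<Rightarrow> nat" where
  "hook_length T u = card (descendants T u)"

definition hook_lengths :: "plane_tree \<Rightarrow> nat multiset" where
  "hook_lengths T = image_mset (hook_length T) (mset_set (vertices T))"

text \<open>
  \<open>card\<close>, \<open>mset_set\<close> and \<open>sum\<close> return default values on infinite sets; the following facts show that
  this never happens here.
\<close>

lemma finite_vertices: "finite (vertices T)"
  by (induction T rule: vertices.induct) auto

lemma card_vertices_subtree:
  assumes "i < length ts"
  shows "card (vertices (ts ! i)) < card (vertices (Node ts))"
proof -
  have "card (vertices (ts ! i)) = card ((#) i ` vertices (ts ! i))"
    by (simp add: card_image)
  also have "\<dots> < card (vertices (Node ts))"
    by (rule psubset_card_mono[OF finite_vertices]) (use assms in auto)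
  finally show ?thesis .
qed

lemma root_in_vertices: "[] \<in> vertices T"
  by (cases T) simp

lemma length_subtrees_less_card_vertices: "length ts < card (vertices (Node ts))"
proof -
  have "(\<lambda>i. [i]) ` {..<length ts} \<subset> vertices (Node ts)"
  proof
    show "(\<lambda>i. [i]) ` {..<length ts} \<subseteq> vertices (Node ts)"
      by (auto simp: root_in_vertices)
    show "(\<lambda>i. [i]) ` {..<length ts} \<noteq> vertices (Node ts)"
      using root_in_vertices[of "Node ts"] by (metis imageE not_Cons_self2)
  qed
  then have "card ((\<lambda>i. [i]) ` {..<length ts}) < card (vertices (Node ts))"
    by (intro psubset_card_mono finite_vertices)
  then show ?thesis by (simp add: card_image inj_on_def)
qed

lemma finite_PT: "finite (PT n)"
proof -
  have "finite {T. card (vertices T) \<le> n}"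
  proof (induction n)
    case 0
    have "\<not> card (vertices T) \<le> 0" for T
      using root_in_vertices[of T] finite_vertices[of T] by (metis card_0_eq empty_iff le_zero_eq)
    then have "{T. card (vertices T) \<le> 0} = {}" by blast
    then show ?case by (metis finite.emptyI)
  next
    case (Suc n)
    let ?S = "{T. card (vertices T) \<le> n}"
    have "T \<in> Node ` {ts. set ts \<subseteq> ?S \<and> length ts \<le> n}" if T: "card (vertices T) \<le> Suc n" for T
    proof (cases T)
      case (Node ts)
      have "set ts \<subseteq> ?S"
      proof
        fix t assume "t \<in> set ts"
        then obtain i where "i < length ts" "t = ts ! i" by (auto simp: in_set_conv_nth)
        then show "t \<in> ?S" using card_vertices_subtree[of i ts] T Node by simp
      qed
      moreover have "length ts \<le> n"
        using length_subtrees_less_card_vertices[of ts] T Node by simp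
      ultimately show ?thesis using Node by blast
    qed
    then have "{T. card (vertices T) \<le> Suc n} \<subseteq> Node ` {ts. set ts \<subseteq> ?S \<and> length ts \<le> n}" by blast
    then show ?case using finite_lists_length_le[OF Suc.IH] finite_surj by blast
  qed
  then show ?thesis by (rule finite_subset[rotated]) (auto simp: PT_def)
qed

end

theory Submission
  imports Defs
begin

text \<open>
  Removing the root turns a tree with \<open>n\<close> vertices into an ordered forest with \<open>n - 1\<close> vertices,
  and splitting off the first tree of a forest gives \<open>c m = (\<Sum>j=1..m. a j * c (m - j))\<close>
  for the weighted counts \<open>a\<close> of trees and \<open>c\<close> of forests. By induction \<open>c m = (m+1)^m / (m+1)!\<close>,
  hence \<open>a j = (1 - 1/j)^(j-1) * c (j-1) = (j-1)^(j-1) / j!\<close>; the convolution of these two sequences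
  is evaluated by Abel's binomial identity
  \<open>(\<Sum>j\<le>m. (m choose j) * x * (x+j)^(j-1) * (z-j)^(m-j)) = (x+z)^m\<close> at \<open>x = -1\<close>.
\<close>

section \<open>Abel's binomial identity\<close>

text \<open>An \<open>m\<close>-th finite difference kills polynomials of degree below
  \<open>m\<close>. In the induction step Pascal's rule yields the difference of the sums for
  \<open>c\<close> and \<open>c + 1\<close>, which lowers the degree by one.\<close>

lemma alternating_binomial_sum_power_eq_0:
  fixes c :: "'a::comm_ring_1"
  assumes "k < m"
  shows "(\<Sum>j\<le>m. (- 1) ^ j * of_nat (m choose j) * (c + of_nat j) ^ k) = 0"
  using assms
proof (induction m arbitrary: c k)
  case (Suc m)
  let ?S = "\<lambda>k c. \<Sum>j\<le>m. (- 1) ^ j * of_nat (m choose j) * (c + of_nat j) ^ k"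
  have "(\<Sum>j\<le>Suc m. (- 1) ^ j * of_nat (Suc m choose j) * (c + of_nat j) ^ k)
      = c ^ k + (\<Sum>j\<le>m. (- 1) ^ Suc j * of_nat (m choose Suc j) * (c + of_nat (Suc j)) ^ k)
        - (\<Sum>j\<le>m. (- 1) ^ j * of_nat (m choose j) * (c + of_nat (Suc j)) ^ k)"
    by (simp only: sum.atMost_Suc_shift)
      (simp add: algebra_simps sum.distrib sum_subtractf sum_negf)
  also have "c ^ k + (\<Sum>j\<le>m. (- 1) ^ Suc j * of_nat (m choose Suc j) * (c + of_nat (Suc j)) ^ k)
      = (\<Sum>j\<le>Suc m. (- 1) ^ j * of_nat (m choose j) * (c + of_nat j) ^ k)"
    by (simp only: sum.atMost_Suc_shift) simp
  also have "\<dots> = ?S k c"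
    by (simp add: binomial_eq_0)
  also have "?S k c - (\<Sum>j\<le>m. (- 1) ^ j * of_nat (m choose j) * (c + of_nat (Suc j)) ^ k)
      = (\<Sum>j\<le>m. (- 1) ^ j * of_nat (m choose j) * ((c + of_nat j) ^ k - (c + of_nat j + 1) ^ k))"
    by (simp add: sum_subtractf[symmetric] algebra_simps)
  \<comment> \<open>The leading powers cancel, so only exponents \<open>i < k\<close> remain; these
    satisfy \<open>i < m\<close>, as the induction hypothesis requires.\<close>
  also have "\<dots> = (\<Sum>j\<le>m. \<Sum>i<k. - of_nat (k choose i) *
                     ((- 1) ^ j * of_nat (m choose j) * (c + of_nat j) ^ i))"
  proof (rule sum.cong[OF refl])
    fix j
    have "(c + of_nat j + 1) ^ k = (\<Sum>i<k. of_nat (k choose i) * (c + of_nat j) ^ i) + (c + of_nat j) ^ k"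
      by (simp add: binomial_ring lessThan_Suc_atMost[symmetric])
    then show "(- 1) ^ j * of_nat (m choose j) * ((c + of_nat j) ^ k - (c + of_nat j + 1) ^ k)
        = (\<Sum>i<k. - of_nat (k choose i) * ((- 1) ^ j * of_nat (m choose j) * (c + of_nat j) ^ i))"
      by (simp add: sum_distrib_left sum_negf mult_ac)
  qed
  also have "\<dots> = (\<Sum>i<k. - of_nat (k choose i) * ?S i c)"
    by (subst sum.swap) (simp add: sum_distrib_left)
  also have "\<dots> = 0"
    using Suc by (intro sum.neutral) auto
  finally show ?case .
qed simp

definition abel_coeff :: "nat \<Rightarrow> real" where
  "abel_coeff j = (if j = 0 then 1 else - ((real j - 1) ^ (j - 1)))"

text \<open>
  \<open>abel_coeff j\<close> is \<open>x * (x+j)^(j-1)\<close> at \<open>x = -1\<close>. Both sides of the identity satisfy \<open>p\<^sub>m' = m * p\<^sub>m\<^sub>-\<^sub>1\<close>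
  as functions of \<open>z\<close>, and at \<open>z = 1\<close> the left-hand side is an \<open>m\<close>-th difference of a polynomial of
  degree \<open>m - 1\<close>.
\<close>

lemma abel_binomial:
  "(\<Sum>j\<le>m. real (m choose j) * abel_coeff j * (z - real j) ^ (m - j)) = (z - 1) ^ m"
proof (induction m arbitrary: z)
  case (Suc m)
  define f where "f z = (\<Sum>j\<le>Suc m. real (Suc m choose j) * abel_coeff j * (z - real j) ^ (Suc m - j))
                         - (z - 1) ^ Suc m" for z
  have deriv: "(f has_real_derivative 0) (at z)" for z
  proof -
    have "(f has_real_derivative
        (\<Sum>j\<le>Suc m. real (Suc m choose j) * abel_coeff j * (real (Suc m - j) * (z - real j) ^ (m - j)))
          - real (Suc m) * (z - 1) ^ m) (at z)"
      unfolding f_def by (auto intro!: derivative_eq_intros sum.cong simp: mult_ac simp del: power_Suc)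
    \<comment> \<open>The factor \<open>Suc m - j\<close> kills the term \<open>j = Suc m\<close>,
      where the subtraction \<open>m - j\<close> is truncated.\<close>
    also have "(\<Sum>j\<le>Suc m. real (Suc m choose j) * abel_coeff j * (real (Suc m - j) * (z - real j) ^ (m - j)))
        = (\<Sum>j\<le>m. real (Suc m choose j) * abel_coeff j * (real (Suc m - j) * (z - real j) ^ (m - j)))"
      by simp
    also have "\<dots> = (\<Sum>j\<le>m. real (Suc m) * (real (m choose j) * abel_coeff j * (z - real j) ^ (m - j)))"
    proof (rule sum.cong[OF refl])
      fix j assume "j \<in> {..m}"
      then have "real (Suc m choose j) * real (Suc m - j) = real (Suc m) * real (m choose j)"
        using binomial_absorb_comp[of "Suc m" j] by (simp only: of_nat_mult[symmetric]) (simp add: mult_ac)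
      then have "(real (Suc m choose j) * real (Suc m - j)) * (abel_coeff j * (z - real j) ^ (m - j))
          = (real (Suc m) * real (m choose j)) * (abel_coeff j * (z - real j) ^ (m - j))"
        by (rule arg_cong)
      then show "real (Suc m choose j) * abel_coeff j * (real (Suc m - j) * (z - real j) ^ (m - j))
          = real (Suc m) * (real (m choose j) * abel_coeff j * (z - real j) ^ (m - j))"
        by (simp only: mult_ac)
    qed
    also have "\<dots> = real (Suc m) * (z - 1) ^ m"
      unfolding sum_distrib_left[symmetric] Suc.IH ..
    finally show ?thesis by simp
  qed
  \<comment> \<open>At \<open>z = 1\<close> both powers have base \<open>j - 1\<close> up to sign,
    and their exponents add up to \<open>m\<close> for every \<open>j > 0\<close>; the value 1 of
    \<open>abel_coeff 0\<close> fits the same formula.\<close>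
  have "abel_coeff j * (1 - real j) ^ (Suc m - j) = (- 1) ^ m * ((- 1) ^ j * (- 1 + real j) ^ m)"
    if "j \<le> Suc m" for j
  proof (cases "j = 0")
    case False
    have "(1 - real j) ^ (Suc m - j) = (- 1) ^ (Suc m - j) * (real j - 1) ^ (Suc m - j)"
      by (simp flip: power_mult_distrib)
    moreover have "(real j - 1) ^ (j - 1) * (real j - 1) ^ (Suc m - j) = (real j - 1) ^ m"
      using False that by (simp flip: power_add)
    moreover have "(- 1) ^ (Suc m - j) = - ((- 1) ^ m * (- 1 :: real) ^ j)"
      using that by (auto simp: minus_one_power_iff)
    ultimately show ?thesis
      using False by (simp add: abel_coeff_def algebra_simps)
  qed (simp add: abel_coeff_def flip: power_add)
  then have "(\<Sum>j\<le>Suc m. real (Suc m choose j) * abel_coeff j * (1 - real j) ^ (Suc m - j))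
      = (- 1) ^ m * (\<Sum>j\<le>Suc m. (- 1) ^ j * real (Suc m choose j) * (- 1 + real j) ^ m)"
    unfolding sum_distrib_left by (intro sum.cong) (auto simp: mult.assoc mult.left_commute)
  also have "\<dots> = 0"
    using alternating_binomial_sum_power_eq_0[of m "Suc m" "- 1 :: real"] by simp
  finally have "f 1 = 0"
    by (simp add: f_def)
  then have "f z = 0"
    using DERIV_isconst_all[of f z 1] deriv by simp
  then show ?case
    by (simp add: f_def)
qed (simp add: abel_coeff_def)

text \<open>
  At \<open>z = m + 1\<close>, a factor \<open>(m+1-j)^(m-j)\<close> is split as
  \<open>(m+1-j)^(m-j-1) + (m-j) * (m+1-j)^(m-j-1)\<close>, and the second part is again an Abel sum, for \<open>m - 1\<close>.
\<close>

lemma abel_convolution: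
  assumes "m \<ge> 1"
  shows "(\<Sum>j=1..m. ((real j - 1) ^ (j - 1) / fact j) *
            (real (Suc (m - j)) ^ (m - j) / fact (Suc (m - j))))
         = real (Suc m) ^ m / fact (Suc m)"
proof -
  define g where "g j = real (Suc (m - j)) ^ (m - j) / fact (Suc (m - j))" for j
  obtain k where m: "m = Suc k" using assms by (cases m) auto
  have summand: "fact m * (abel_coeff j / fact j * g j)
      = real (m choose j) * abel_coeff j * (real (Suc m) - real j) ^ (m - j)
        - real m * (real (k choose j) * abel_coeff j * (real (Suc m) - real j) ^ (k - j))"
    if j: "j \<le> m" for j
  \<comment> \<open>For \<open>j = m\<close> the second term vanishes because
    \<open>k choose m = 0\<close>, whatever the truncated exponent \<open>k - j\<close> is.\<close>
  proof (cases "j = m")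
    case True
    then show ?thesis by (simp add: g_def m)
  next
    case False
    then have jk: "j \<le> k" using j m by simp
    define d where "d = k - j"
    have md: "m - j = Suc d" and kd: "k = j + d" using jk m d_def by auto
    have b1: "real (m choose j) = fact m / (fact j * fact (Suc d))"
      using binomial_fact[of j m, where 'a=real] j md by simp
    have b2: "real (k choose j) = fact k / (fact j * fact d)"
      using binomial_fact[of j k, where 'a=real] jk d_def by simp
    have fm: "(fact m :: real) = real m * fact k" by (simp add: m)
    have z: "real (Suc m) - real j = real d + 2" using m kd by simp
    have r: "real m * (real (k choose j) * abel_coeff j * (real (Suc m) - real j) ^ (k - j))
        = fact m / (fact j * fact d) * abel_coeff j * (real d + 2) ^ d"
      unfolding b2 z d_def[symmetric] fm by simp
    have l: "fact m * (abel_coeff j / fact j * g j)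
        = fact m / fact j * abel_coeff j * (real d + 2) ^ d / fact (Suc d)"
    proof -
      have "g j = (real d + 2) ^ Suc d / ((real d + 2) * fact (Suc d))"
        unfolding g_def md by (simp add: add.commute)
      also have "\<dots> = (real d + 2) ^ d / fact (Suc d)"
        by simp
      finally show ?thesis by simp
    qed
    \<comment> \<open>With \<open>s = d + 1\<close> this is \<open>1/s = (s + 1)/s - 1\<close>,
      where \<open>s * D\<close> is \<open>(d+1)!\<close> and \<open>(s + 1) * P\<close> is
      \<open>(d+2)^(d+1)\<close>.\<close>
    have split: "F / J * A * P / (s * D) = F / (J * (s * D)) * A * ((s + 1) * P) - F / (J * D) * A * P"
      if "s \<noteq> 0" "J \<noteq> 0" "D \<noteq> 0" for F J A P s D :: real
      using that by (simp add: field_simps)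
    show ?thesis
      unfolding r l unfolding b1 z md
      using split[of "real d + 1" "fact j" "fact d" "fact m" "abel_coeff j" "(real d + 2) ^ d"]
      by (simp add: add.commute)
  qed
  have "fact m * (\<Sum>j\<le>m. abel_coeff j / fact j * g j)
      = (\<Sum>j\<le>m. real (m choose j) * abel_coeff j * (real (Suc m) - real j) ^ (m - j))
        - real m * (\<Sum>j\<le>m. real (k choose j) * abel_coeff j * (real (Suc m) - real j) ^ (k - j))"
    unfolding sum_distrib_left sum_subtractf[symmetric] using summand by (intro sum.cong) auto
  also have "(\<Sum>j\<le>m. real (k choose j) * abel_coeff j * (real (Suc m) - real j) ^ (k - j)) = real m ^ k"
    using abel_binomial[of k "real (Suc m)"] by (simp add: m)
  also have "(\<Sum>j\<le>m. real (m choose j) * abel_coeff j * (real (Suc m) - real j) ^ (m - j)) = real m ^ m"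
    using abel_binomial[of m "real (Suc m)"] by simp
  \<comment> \<open>The two Abel sums cancel: \<open>m^m = m * m^k\<close>. The term
    \<open>j = 0\<close> is then the desired right-hand side, and the others carry a minus
    sign.\<close>
  finally have "(\<Sum>j\<le>m. abel_coeff j / fact j * g j) = 0"
    by (simp add: m)
  moreover have "(\<Sum>j\<le>m. abel_coeff j / fact j * g j)
      = g 0 + (\<Sum>j=1..m. abel_coeff j / fact j * g j)"
    by (simp add: atMost_atLeast0 sum.atLeast_Suc_atMost abel_coeff_def)
  moreover have "(\<Sum>j=1..m. abel_coeff j / fact j * g j)
      = - (\<Sum>j=1..m. (real j - 1) ^ (j - 1) / fact j * g j)"
    unfolding sum_negf[symmetric] by (intro sum.cong) (auto simp: abel_coeff_def)
  ultimately show ?thesis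
    by (simp add: g_def)
qed

section \<open>Hook weights of trees and forests\<close>

definition forest_size :: "plane_tree list \<Rightarrow> nat" where
  "forest_size ts = (\<Sum>t\<leftarrow>ts. card (vertices t))"

definition forests :: "nat \<Rightarrow> plane_tree list set" where
  "forests m = {ts. forest_size ts = m}"

definition hook_prod :: "(nat \<Rightarrow> 'a::comm_monoid_mult) \<Rightarrow> plane_tree \<Rightarrow> 'a" where
  "hook_prod f T = (\<Prod>h\<in>#hook_lengths T. f h)"

lemma hook_prod_eq_prod_vertices: "hook_prod f T = (\<Prod>v\<in>vertices T. f (hook_length T v))"
  by (simp add: hook_prod_def hook_lengths_def prod_unfold_prod_mset image_mset.compositionality o_def)

lemma card_vertices_Node: "card (vertices (Node ts)) = Suc (forest_size ts)"
proof -
  have "card (\<Union>i<length ts. (#) i ` vertices (ts ! i)) = (\<Sum>i<length ts. card ((#) i ` vertices (ts ! i)))"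
    by (rule card_UN_disjoint) (auto simp: finite_vertices)
  also have "\<dots> = forest_size ts"
    by (simp add: forest_size_def card_image sum.list_conv_set_nth atLeast0LessThan)
  finally show ?thesis
    by (subst vertices.simps, subst card_insert_disjoint) (auto simp: finite_vertices)
qed

lemma hook_length_root: "hook_length T [] = card (vertices T)"
  by (simp add: hook_length_def descendants_def)

text \<open>All descendants of a non-root vertex lie in the same subtree of the root, so its hook
  length can be computed there.\<close>

lemma hook_length_Node_Cons:
  assumes "i < length ts"
  shows "hook_length (Node ts) (i # v) = hook_length (ts ! i) v"
proof -
  have "descendants (Node ts) (i # v) = (#) i ` descendants (ts ! i) v"
    using assms by (auto simp: descendants_def)
  then show ?thesis
    by (simp add: hook_length_def card_image)
qed

lemma hook_prod_Node:
  "hook_prod f (Node ts) = f (Suc (forest_size ts)) * (\<Prod>t\<leftarrow>ts. hook_prod f t)"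
proof -
  let ?U = "\<Union>i<length ts. (#) i ` vertices (ts ! i)"
  have "hook_prod f (Node ts)
      = f (hook_length (Node ts) []) * (\<Prod>v\<in>?U. f (hook_length (Node ts) v))"
    unfolding hook_prod_eq_prod_vertices vertices.simps
    by (rule prod.insert) (auto simp: finite_vertices)
  also have "(\<Prod>v\<in>?U. f (hook_length (Node ts) v))
      = (\<Prod>i<length ts. \<Prod>v\<in>(#) i ` vertices (ts ! i). f (hook_length (Node ts) v))"
    by (rule prod.UNION_disjoint) (auto simp: finite_vertices)
  also have "\<dots> = (\<Prod>i<length ts. hook_prod f (ts ! i))"
    by (rule prod.cong) (auto simp: prod.reindex hook_length_Node_Cons hook_prod_eq_prod_vertices)
  also have "\<dots> = (\<Prod>t\<leftarrow>ts. hook_prod f t)"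
    by (simp add: prod.list_conv_set_nth atLeast0LessThan)
  finally show ?thesis
    by (simp add: hook_length_root card_vertices_Node del: vertices.simps)
qed

lemma PT_Suc: "PT (Suc m) = Node ` forests m"
proof -
  have "T \<in> PT (Suc m) \<longleftrightarrow> T \<in> Node ` forests m" for T
    by (cases T) (auto simp: PT_def forests_def card_vertices_Node simp del: vertices.simps)
  then show ?thesis by blast
qed

lemma finite_forests: "finite (forests m)"
  using finite_PT[of "Suc m"] by (simp add: PT_Suc finite_image_iff inj_on_def)

lemma sum_hook_prod_PT_Suc:
  fixes f :: "nat \<Rightarrow> 'a::comm_semiring_1"
  shows "(\<Sum>T\<in>PT (Suc m). hook_prod f T) = f (Suc m) * (\<Sum>ts\<in>forests m. \<Prod>t\<leftarrow>ts. hook_prod f t)"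
  by (simp add: PT_Suc sum.reindex inj_on_def hook_prod_Node forests_def sum_distrib_left)

lemma card_vertices_pos: "card (vertices T) > 0"
  by (cases T) (simp add: card_vertices_Node del: vertices.simps)

lemma forest_size_simps [simp]:
  "forest_size [] = 0"
  "forest_size (t # ts) = card (vertices t) + forest_size ts"
  by (simp_all add: forest_size_def)

lemma forests_0: "forests 0 = {[]}"
proof -
  have "ts \<in> forests 0 \<longleftrightarrow> ts = []" for ts
    using card_vertices_pos by (cases ts) (simp_all add: forests_def)
  then show ?thesis by blast
qed

text \<open>The index \<open>j\<close> is the size of the first tree. It is at least 1, so the
  remaining forest is strictly smaller, and the blocks for different \<open>j\<close> are
  disjoint.\<close>

lemma forests_decompose:
  assumes "m \<ge> 1"
  shows "forests m = (\<Union>j\<in>{1..m}. (\<lambda>(t, ts). t # ts) ` (PT j \<times> forests (m - j)))"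
proof (intro equalityI subsetI)
  fix ts assume "ts \<in> forests m"
  then obtain t us where "ts = t # us" "card (vertices t) + forest_size us = m"
    using assms by (cases ts) (auto simp: forests_def)
  then show "ts \<in> (\<Union>j\<in>{1..m}. (\<lambda>(t, ts). t # ts) ` (PT j \<times> forests (m - j)))"
    using card_vertices_pos[of t]
    by (intro UN_I[of "card (vertices t)"]) (auto simp: PT_def forests_def)
qed (auto simp: PT_def forests_def)

lemma sum_forests_decompose:
  fixes w :: "plane_tree \<Rightarrow> 'a::comm_semiring_1"
  assumes "m \<ge> 1"
  shows "(\<Sum>ts\<in>forests m. \<Prod>t\<leftarrow>ts. w t)
       = (\<Sum>j=1..m. (\<Sum>T\<in>PT j. w T) * (\<Sum>ts\<in>forests (m - j). \<Prod>t\<leftarrow>ts. w t))"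
proof -
  let ?C = "\<lambda>j. (\<lambda>(t, ts). t # ts) ` (PT j \<times> forests (m - j))"
  have "(\<Sum>ts\<in>forests m. \<Prod>t\<leftarrow>ts. w t) = (\<Sum>j=1..m. \<Sum>ts\<in>?C j. \<Prod>t\<leftarrow>ts. w t)"
    unfolding forests_decompose[OF assms]
    by (rule sum.UNION_disjoint, auto simp: finite_PT finite_forests) (auto simp: PT_def)
  also have "\<dots> = (\<Sum>j=1..m. \<Sum>(T, ts)\<in>PT j \<times> forests (m - j). w T * (\<Prod>t\<leftarrow>ts. w t))"
    by (subst sum.reindex) (auto simp: inj_on_def case_prod_unfold)
  finally show ?thesis
    by (simp add: sum_product sum.cartesian_product)
qed

section \<open>The hook length formula\<close>

abbreviation hook_weight :: "nat \<Rightarrow> real" where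
  "hook_weight h \<equiv> (1 - 1 / real h) ^ (h - 1)"

text \<open>The factor \<open>j^(j-1) / j!\<close> is the total weight of forests with
  \<open>j - 1\<close> vertices; the root's weight turns it into that of trees with \<open>j\<close>
  vertices. For \<open>j = 1\<close> both powers are \<open>0^0 = 1\<close>.\<close>

lemma hook_weight_mult:
  assumes "j \<ge> 1"
  shows "hook_weight j * (real j ^ (j - 1) / fact j) = (real j - 1) ^ (j - 1) / fact j"
proof -
  have "(1 - 1 / real j) * real j = real j - 1"
    using assms by (simp add: field_simps)
  then have "hook_weight j * real j ^ (j - 1) = (real j - 1) ^ (j - 1)"
    by (simp flip: power_mult_distrib)
  then show ?thesis by simp
qed

text \<open>The forest formula is an assumption so that this step can be used for smaller sizes
  within the induction proving that formula.\<close>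

lemma sum_hook_prod_PT_hook_weight:
  assumes "(\<Sum>ts\<in>forests m. \<Prod>t\<leftarrow>ts. hook_prod hook_weight t) = real (Suc m) ^ m / fact (Suc m)"
  shows "(\<Sum>T\<in>PT (Suc m). hook_prod hook_weight T) = real m ^ m / fact (Suc m)"
  unfolding sum_hook_prod_PT_Suc assms using hook_weight_mult[of "Suc m"] by simp

lemma sum_hook_weight_forests:
  "(\<Sum>ts\<in>forests m. \<Prod>t\<leftarrow>ts. hook_prod hook_weight t) = real (Suc m) ^ m / fact (Suc m)"
proof (induction m rule: less_induct)
  case (less m)
  show ?case
  proof (cases "m = 0")
    case True
    then show ?thesis by (simp add: forests_0)
  next
    case False
    then have m: "m \<ge> 1" by simp
    \<comment> \<open>Trees with \<open>j <= m\<close> vertices need the forest formula only at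
      \<open>j - 1 < m\<close>.\<close>
    have trees: "(\<Sum>T\<in>PT j. hook_prod hook_weight T) = (real j - 1) ^ (j - 1) / fact j"
      if "j \<in> {1..m}" for j
      using that sum_hook_prod_PT_hook_weight[of "j - 1"] less.IH[of "j - 1"] by auto
    show ?thesis
      unfolding sum_forests_decompose[OF m] abel_convolution[OF m, symmetric]
      using trees less.IH by (intro sum.cong arg_cong2[where f = "(*)"]) auto
  qed
qed

theorem theorem3p3:
  fixes n :: nat
  assumes "n \<ge> 1"
  shows "fact n * (\<Sum>T\<in>PT n. \<Prod>h\<in>#hook_lengths T. (1 - 1 / real h) ^ (h - 1))
           = (real n - 1) ^ (n - 1)"
proof -
  have "(\<Sum>T\<in>PT n. hook_prod hook_weight T) = (real n - 1) ^ (n - 1) / fact n"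
    using assms sum_hook_prod_PT_hook_weight[OF sum_hook_weight_forests, of "n - 1"]
    by simp
  then show ?thesis
    by (simp add: hook_prod_def)
qed

end
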